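(* Let $d\in\{1,2,3\}$ and let $K\subset M^{m\times n}$ be a $d$-dimensional linear subspace. Then $\mathcal{M}^{pc}(K)$ consists of Dirac measures if and only if $K$ does not contain Rank-$1$ connections.
   Context: $M^{m\times n}$ denotes real $m\times n$ matrices. For $X\in M^{m\times n}$, $\hat X$ is the vector of all minors of $X$; $f$ is polyconvex if $f(X)=g(\hat X)$ with $g$ convex. For $\mathcal{K}\subset M^{m\times n}$, $\mathcal{M}^{pc}(\mathcal{K})$ is the set of probability measures $\nu$ with $\mathrm{Spt}\,\nu\subset\mathcal{K}$ and $\int f\,d\nu\ge f(\int X\,d\nu)$ for all polyconvex $f$ (equivalently $\nu$ commutes with all minors). A set $\Sigma$ has Rank-$1$ connections if there exist $A\ne B$ in $\Sigma$ with $\mathrm{Rank}(A-B)=1$. *)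

theory Defs
  imports "HOL-Analysis.Analysis" "HOL-Probability.Probability"
begin

definition det_k :: "nat \<Rightarrow> (nat \<Rightarrow> nat \<Rightarrow> real) \<Rightarrow> real" where
  "det_k k M = (\<Sum>p | p permutes {..<k}. of_int (sign p) * (\<Prod>i<k. M i (p i)))"

definition minor :: "real^'n::{finite,linorder}^'m::{finite,linorder} \<Rightarrow> 'm set \<Rightarrow> 'n set \<Rightarrow> real" where
  "minor X I J = det_k (card I)
     (\<lambda>i j. X $ (sorted_list_of_set I ! i) $ (sorted_list_of_set J ! j))"

definition minors :: "real^'n::{finite,linorder}^'m::{finite,linorder} \<Rightarrow> real^('m set \<times> 'n set)" where
  "minors X = (\<chi> IJ. if card (fst IJ) = card (snd IJ) \<and> card (fst IJ) \<ge> 1 then minor X (fst IJ) (snd IJ) else 0)"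

definition polyconvex :: "(real^'n::{finite,linorder}^'m::{finite,linorder} \<Rightarrow> real) \<Rightarrow> bool" where
  "polyconvex f \<longleftrightarrow> (\<exists>g. convex_on UNIV g \<and> (\<forall>X. f X = g (minors X)))"

definition Spt :: "'a::metric_space measure \<Rightarrow> 'a set" where
  "Spt \<nu> = {x. \<forall>e>0. emeasure \<nu> (ball x e) \<noteq> 0}"

text \<open>Polyconvex measures supported in K: Borel probability measures whose minors are
  integrable (so that all quantities are defined) and which satisfy Jensen's inequality
  for every integrable polyconvex function.\<close>
definition Mpc :: "(real^'n::{finite,linorder}^'m::{finite,linorder}) set
    \<Rightarrow> (real^'n::{finite,linorder}^'m::{finite,linorder}) measure set" where
  "Mpc K = {\<nu>. prob_space \<nu> \<and> sets \<nu> = sets borel \<and> Spt \<nu> \<subseteq> K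
      \<and> integrable \<nu> (\<lambda>X. X) \<and> integrable \<nu> minors
      \<and> (\<forall>f. polyconvex f \<longrightarrow> integrable \<nu> f \<longrightarrow>
             f (integral\<^sup>L \<nu> (\<lambda>X. X)) \<le> integral\<^sup>L \<nu> f)}"

definition rank1_connections :: "(real^'n^'m) set \<Rightarrow> bool" where
  "rank1_connections \<Sigma> \<longleftrightarrow> (\<exists>A\<in>\<Sigma>. \<exists>B\<in>\<Sigma>. A \<noteq> B \<and> rank (A - B) = 1)"

end

theory Submission
  imports Defs
begin

text \<open>Only the 2 by 2 minors matter. If the subspace \<open>K\<close> contains no rank-one matrix and
  has dimension at most 3, then some linear combination \<open>q\<close> of 2 by 2 minors is positive definite
  on \<open>K\<close>. A polyconvex measure with barycentre \<open>Z\<close> satisfies \<open>\<integral> q (X - Z) = 0\<close>, so it is concentrated at \<open>Z\<close>.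

  By separation, if no such \<open>q\<close> exists, there are finitely many matrices \<open>Y\<^sub>i\<close> in \<open>K\<close>, not all zero, whose
  2 by 2 minors add up to zero. The bilinear map \<open>v x y = (x \<bullet> Y\<^sub>i y)\<^sub>i\<close> then has the exchange symmetry
  \<open>v x y \<bullet> v x' y' = v x y' \<bullet> v x' y\<close>, its values span a space \<open>S\<close> of dimension at most 3, and a
  vector \<open>c\<close> such that \<open>c \<bullet> v x y\<close> is a nonzero product \<open>\<alpha> x * \<beta> y\<close> yields the rank-one matrix
  \<open>\<Sum>c\<^sub>i Y\<^sub>i\<close> in \<open>K\<close>. For generic \<open>x\<^sub>0\<close>, the kernel of \<open>v x\<^sub>0\<close> is contained in that of every \<open>v x\<close>. If
  \<open>v x\<^sub>0\<close> maps onto \<open>S\<close>, the maps \<open>v x \<circ> (v x\<^sub>0)\<^sup>-\<^sup>1\<close> are commuting self-adjoint operators on \<open>S\<close>,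
  and \<open>c\<close> is a common eigenvector; likewise with the two arguments exchanged. Otherwise \<open>v x\<close>
  depends on \<open>x\<close> only through a quotient of dimension at most 2, and any nonzero \<open>c\<close> in \<open>S\<close>
  orthogonal to the range of \<open>v x\<^sub>0\<close> works.

  Conversely, for a rank-one matrix \<open>C\<close> in \<open>K\<close>, all minors of order at least 2 vanish at \<open>C\<close> and \<open>-C\<close>,
  so the uniform measure on \<open>{C, -C}\<close> is polyconvex.\<close>

section \<open>Bilinear maps with exchange symmetry\<close>

text \<open>A maximiser \<open>u\<close> of \<open>M z \<bullet> z\<close> on the unit sphere of
  \<open>H\<close> works: the form \<open>q\<close> is nonnegative on \<open>H\<close> and vanishes
  at \<open>u\<close>, so its gradient there is zero.\<close>

lemma selfadjoint_eigenvector: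
  fixes M :: "'e::euclidean_space \<Rightarrow> 'e"
  assumes lin: "linear M" and sub: "subspace H" and nz: "H \<noteq> {0}"
    and inv: "M ` H \<subseteq> H"
    and sa: "\<And>a b. a \<in> H \<Longrightarrow> b \<in> H \<Longrightarrow> M a \<bullet> b = a \<bullet> M b"
  obtains l c where "c \<in> H" "c \<noteq> 0" "M c = l *\<^sub>R c"
proof -
  let ?S = "sphere 0 1 \<inter> H"
  have "compact ?S"
    using closed_subspace[OF sub] by (simp add: compact_Int_closed)
  moreover obtain h where h: "h \<in> H" "h \<noteq> 0"
    using nz subspace_0[OF sub] by blast
  then have "(1 / norm h) *\<^sub>R h \<in> ?S"
    using sub by (simp add: subspace_scale)
  moreover have "continuous_on ?S (\<lambda>z. M z \<bullet> z)"
    using lin by (intro continuous_intros linear_continuous_on) (simp add: linear_conv_bounded_linear)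
  ultimately obtain u where u: "u \<in> ?S" and max: "\<And>z. z \<in> ?S \<Longrightarrow> M z \<bullet> z \<le> M u \<bullet> u"
    using continuous_attains_sup[of ?S "\<lambda>z. M z \<bullet> z"] by blast
  define l where "l = M u \<bullet> u"
  define q where "q z = l * (z \<bullet> z) - M z \<bullet> z" for z
  have q_nonneg: "q z \<ge> 0" if "z \<in> H" for z
  proof (cases "z = 0")
    case True
    then show ?thesis by (simp add: q_def)
  next
    case False
    have "(1 / norm z) *\<^sub>R z \<in> ?S"
      using sub that False by (simp add: subspace_scale)
    from max[OF this] have "(M z \<bullet> z) / (norm z * norm z) \<le> l"
      by (simp add: l_def linear_scale[OF lin])
    then show ?thesis
      using False by (simp add: q_def dot_square_norm power2_eq_square divide_simps)
  qed
  \<comment> \<open>\<open>w\<close> is half the gradient of \<open>q\<close> at \<open>u\<close>;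
    moving from \<open>u\<close> against it would make \<open>q\<close> negative unless
    \<open>w = 0\<close>.\<close>
  define w where "w = l *\<^sub>R u - M u"
  have uH: "u \<in> H" and wH: "w \<in> H"
    using u inv sub by (auto simp: w_def intro!: subspace_diff subspace_scale)
  have uu: "u \<bullet> u = 1"
    using u by (simp add: dot_square_norm)
  have expand: "q (u - t *\<^sub>R w) = t^2 * q w - 2 * t * (w \<bullet> w)" for t
  proof -
    have "M w \<bullet> u = M u \<bullet> w"
      using sa[OF wH uH] by (simp add: inner_commute)
    moreover have "w \<bullet> w = l * (u \<bullet> w) - M u \<bullet> w"
      by (subst w_def) (simp add: inner_diff_left)
    then have "2 * t * (w \<bullet> w) = 2 * t * (l * (u \<bullet> w)) - 2 * t * (M u \<bullet> w)"
      by (simp add: right_diff_distrib)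
    ultimately show ?thesis
      using l_def by (simp add: q_def linear_diff[OF lin] linear_scale[OF lin] inner_diff_left
          inner_diff_right uu algebra_simps power2_eq_square inner_commute)
  qed
  have nonneg: "t^2 * q w - 2 * t * (w \<bullet> w) \<ge> 0" for t
    using q_nonneg[of "u - t *\<^sub>R w"] uH wH sub
    by (simp add: expand subspace_diff subspace_scale)
  have "w = 0"
  proof (rule ccontr)
    assume "w \<noteq> 0"
    then have ww: "w \<bullet> w > 0" by simp
    \<comment> \<open>\<open>t = 1\<close> shows that \<open>q w\<close> is positive, so the
      minimiser \<open>t = (w \<bullet> w) / q w\<close> of the quadratic in \<open>t\<close> may be
      inserted.\<close>
    have "0 < 2 * (w \<bullet> w)" using ww by simp
    also have "\<dots> \<le> q w" using nonneg[of 1] by simp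
    finally have "q w > 0" .
    then have "((w \<bullet> w) / q w)^2 * q w = (w \<bullet> w) / q w * (w \<bullet> w)"
      by (simp add: power2_eq_square)
    then have "(w \<bullet> w) / q w * (w \<bullet> w) \<le> 0"
      using nonneg[of "(w \<bullet> w) / q w"] by simp
    moreover have "(w \<bullet> w) / q w * (w \<bullet> w) > 0"
      using ww \<open>q w > 0\<close> by simp
    ultimately show False by simp
  qed
  then show thesis
    using that[of u l] uH uu by (metis eq_iff_diff_eq_0 inner_zero_left w_def zero_neq_one)
qed

text \<open>On a nonzero jointly invariant subspace of least dimension every \<open>M i\<close> is a
  scalar: its eigenspace there is again jointly invariant by commutativity, hence everything. The
  index set may be infinite.\<close>

lemma commuting_selfadjoint_common_eigenvector:
  fixes M :: "'i \<Rightarrow> 'e::euclidean_space \<Rightarrow> 'e"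
  assumes lin: "\<And>i. linear (M i)" and sub: "subspace S" and nz: "S \<noteq> {0}"
    and inv: "\<And>i. M i ` S \<subseteq> S"
    and sa: "\<And>i a b. a \<in> S \<Longrightarrow> b \<in> S \<Longrightarrow> M i a \<bullet> b = a \<bullet> M i b"
    and comm: "\<And>i j a. a \<in> S \<Longrightarrow> M i (M j a) = M j (M i a)"
  obtains c l where "c \<in> S" "c \<noteq> 0" "\<And>i. M i c = l i *\<^sub>R c"
proof -
  let ?P = "\<lambda>H. subspace H \<and> H \<noteq> {0} \<and> H \<subseteq> S \<and> (\<forall>i. M i ` H \<subseteq> H)"
  have "?P S" using sub nz inv by blast
  then obtain H where H: "?P H" and min: "\<And>H'. ?P H' \<Longrightarrow> dim H \<le> dim H'"
    using ex_has_least_nat[of ?P S dim] by blast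
  have scalar: "\<exists>l. \<forall>z\<in>H. M i z = l *\<^sub>R z" for i
  proof -
    obtain l c where c: "c \<in> H" "c \<noteq> 0" "M i c = l *\<^sub>R c"
      by (rule selfadjoint_eigenvector[OF lin[of i], of H]) (use H sa in blast)+
    let ?H = "{z \<in> H. M i z = l *\<^sub>R z}"
    have "subspace ?H"
      using H lin[of i] by (auto simp: subspace_def linear_add linear_scale linear_0 algebra_simps)
    moreover have "M j ` ?H \<subseteq> ?H" for j
    proof (rule image_subsetI)
      fix z assume z: "z \<in> ?H"
      then have "M i (M j z) = l *\<^sub>R M j z"
        using H comm[of z i j] lin[of j] by (auto simp: linear_scale)
      then show "M j z \<in> ?H" using H z by blast
    qed
    moreover have "?H \<noteq> {0}" using c by blast
    ultimately have "dim H \<le> dim ?H"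
      using H by (intro min) blast
    moreover have "?H \<subseteq> H" by blast
    ultimately have "?H = H"
      using \<open>subspace ?H\<close> H by (intro subspace_dim_equal) auto
    then show ?thesis by blast
  qed
  then obtain l where "\<And>i z. z \<in> H \<Longrightarrow> M i z = l i *\<^sub>R z" by metis
  moreover obtain c where "c \<in> H" "c \<noteq> 0" using H subspace_0 by blast
  ultimately show thesis using that[of c l] H by (metis subsetD)
qed

section \<open>Kernels and product functionals of bilinear maps\<close>

text \<open>Any \<open>x0\<close> whose kernel has least dimension works: a small perturbation of
  \<open>x0\<close> towards \<open>x\<close> can only shrink the kernel, and minimality forbids
  that.\<close>

lemma generic_kernel:
  fixes v :: "'a::euclidean_space \<Rightarrow> 'b::euclidean_space \<Rightarrow> 'e::euclidean_space"
  assumes bil: "bilinear v"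
    and sym: "\<And>x y x' y'. v x y \<bullet> v x' y' = v x y' \<bullet> v x' y"
  obtains x0 where "\<And>x y. v x0 y = 0 \<Longrightarrow> v x y = 0"
proof -
  have lin: "linear (v x)" for x
    using bil by (simp add: bilinear_def)
  have sub: "subspace {y. v x y = 0}" for x
    by (rule linear_subspace_kernel[OF lin])
  obtain x0 where min: "\<And>x. dim {y. v x0 y = 0} \<le> dim {y. v x y = 0}"
    using ex_has_least_nat[of "\<lambda>_. True" undefined "\<lambda>x. dim {y. v x y = 0}"] by blast
  have "v x y = 0" if "v x0 y = 0" for x y
  proof -
    let ?A = "v x0" and ?B = "v x"
    have adjA: "adjoint ?A u \<bullet> y = u \<bullet> ?A y" and adjB: "adjoint ?B u \<bullet> y = u \<bullet> ?B y" for u y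
      using adjoint_works[OF lin, of y] by (metis inner_commute)+
    have linA: "linear (adjoint ?A)" and linB: "linear (adjoint ?B)"
      by (simp_all add: adjoint_linear lin)
    \<comment> \<open>The adjoint of \<open>?A\<close> is injective on the range of
      \<open>?A\<close>, hence bounded below there by some \<open>e\<close>.\<close>
    have "\<exists>e>0. \<forall>u\<in>range ?A. norm (adjoint ?A u) \<ge> e * norm u"
    proof (rule injective_imp_isometric)
      show "closed (range ?A)" "subspace (range ?A)"
        using linear_subspace_image[OF lin subspace_UNIV] closed_subspace by blast+
      show "bounded_linear (adjoint ?A)"
        using linA by (simp add: linear_conv_bounded_linear)
      show "\<forall>u\<in>range ?A. adjoint ?A u = 0 \<longrightarrow> u = 0"
        using adjA by (metis imageE inner_eq_zero_iff inner_zero_left)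
    qed
    then obtain e where e: "e > 0" "\<And>z. norm (adjoint ?A (?A z)) \<ge> e * norm (?A z)" by auto
    obtain C where C: "C > 0" "\<And>u. norm (adjoint ?B u) \<le> norm u * C"
      using bounded_linear.pos_bounded linB by (metis linear_conv_bounded_linear)
    \<comment> \<open>With \<open>t * C < e\<close>, the estimate
      \<open>e * norm (?A z) \<le> t * C * norm (?A z)\<close> obtained below forces
      \<open>?A z = 0\<close>.\<close>
    define t where "t = e / (2 * C)"
    have t: "t > 0" "t * C < e" using e C by (auto simp: t_def)
    \<comment> \<open>For small \<open>t\<close>, the exchange symmetry forces \<open>ker (A + t B) = ker A \<inter> ker B\<close>, so by minimality
      \<open>ker A \<subseteq> ker B\<close>.\<close>
    have small: "?A z = 0 \<and> ?B z = 0" if z: "v (x0 + t *\<^sub>R x) z = 0" for z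
    proof -
      have sum0: "?A z + t *\<^sub>R ?B z = 0"
        using z bil by (simp add: bilinear_ladd bilinear_lmul)
      \<comment> \<open>Exchange symmetry says that \<open>adjoint ?A \<circ> ?B\<close> equals
        \<open>adjoint ?B \<circ> ?A\<close>.\<close>
      have "adjoint ?A (?A z) = - t *\<^sub>R adjoint ?B (?A z)"
      proof (rule vector_eq_rdot[THEN iffD1], rule allI)
        fix y
        have "?A z = - t *\<^sub>R ?B z" using sum0 by (simp add: eq_neg_iff_add_eq_0)
        then have "?A z \<bullet> ?A y = - t * (?B z \<bullet> ?A y)" by (metis inner_scaleR_left)
        also have "?B z \<bullet> ?A y = ?A z \<bullet> ?B y" using sym[of x z x0 y] by (simp add: inner_commute)
        finally show "adjoint ?A (?A z) \<bullet> y = (- t *\<^sub>R adjoint ?B (?A z)) \<bullet> y"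
          by (simp add: adjA adjB)
      qed
      then have "e * norm (?A z) \<le> t * norm (adjoint ?B (?A z))"
        using e(2)[of z] t by simp
      also have "\<dots> \<le> t * (norm (?A z) * C)"
        using C t by (simp add: mult_left_mono)
      finally have "(e - t * C) * norm (?A z) \<le> 0" by (simp add: algebra_simps)
      then have "?A z = 0" using t by (simp add: mult_le_0_iff)
      then show ?thesis using sum0 t by simp
    qed
    let ?N = "{y. v x0 y = 0}" and ?N' = "{y. v (x0 + t *\<^sub>R x) y = 0}"
    have "?N' \<subseteq> ?N" using small by blast
    then have "?N' = ?N"
      using min[of "x0 + t *\<^sub>R x"] sub by (intro subspace_dim_equal) auto
    then show ?thesis using small that by blast
  qed
  then show thesis using that by blast
qed

text \<open>For a common eigenvector \<open>c\<close> of the operators \<open>M x\<close>,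
  self-adjointness moves \<open>M x\<close> from \<open>v x0 y\<close> onto \<open>c\<close>; so
  \<open>\<alpha>\<close> is the eigenvalue and \<open>\<beta> y\<close> is
  \<open>c \<bullet> v x0 y\<close>.\<close>

lemma product_functional_if_surjective:
  fixes v :: "'a::euclidean_space \<Rightarrow> 'b::euclidean_space \<Rightarrow> 'e::euclidean_space"
  assumes bil: "bilinear v"
    and sym: "\<And>x y x' y'. v x y \<bullet> v x' y' = v x y' \<bullet> v x' y"
    and ker: "\<And>x y. v x0 y = 0 \<Longrightarrow> v x y = 0"
    and surj: "\<And>x y. v x y \<in> range (v x0)"
    and nz: "v x1 y1 \<noteq> 0"
  shows "\<exists>c \<alpha> \<beta>. (\<forall>x y. c \<bullet> v x y = \<alpha> x * \<beta> y) \<and> (\<exists>x y. c \<bullet> v x y \<noteq> 0)"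
proof -
  have lin: "linear (v x)" for x
    using bil by (simp add: bilinear_def)
  obtain g where lg: "linear g" and g: "\<And>y. v x0 (g (v x0 y)) = v x0 y"
    using linear_exists_right_inverse_on[OF lin subspace_UNIV, of x0] by auto
  define M where "M x = v x \<circ> g" for x
  have M: "M x (v x0 y) = v x y" for x y
  proof -
    \<comment> \<open>The kernel hypothesis makes \<open>M x\<close> independent of the choice of
      the right inverse \<open>g\<close>.\<close>
    have "v x0 (g (v x0 y) - y) = 0" by (simp add: linear_diff[OF lin] g)
    then have "v x (g (v x0 y) - y) = 0" by (rule ker)
    then show ?thesis by (simp add: linear_diff[OF lin] M_def)
  qed
  let ?S = "range (v x0)"
  have sub: "subspace ?S" using linear_subspace_image[OF lin subspace_UNIV] .
  have sa: "M x a \<bullet> b = a \<bullet> M x b" if "a \<in> ?S" "b \<in> ?S" for x a b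
    using that sym by (auto simp: M) (metis inner_commute)
  have MS: "M x a \<in> ?S" for x a
    using surj by (auto simp: M_def)
  have comm: "M x (M x' a) = M x' (M x a)" if a: "a \<in> ?S" for x x' a
  proof -
    \<comment> \<open>Testing against \<open>b\<close> in \<open>?S\<close> suffices, because the
      commutator applied to \<open>a\<close> lies in \<open>?S\<close> itself.\<close>
    have "M x (M x' a) \<bullet> b = M x' (M x a) \<bullet> b" if b: "b \<in> ?S" for b
    proof -
      have "M x (M x' a) \<bullet> b = M x' a \<bullet> M x b" by (rule sa[OF MS b])
      also have "\<dots> = M x a \<bullet> M x' b"
        using a b sym by (auto simp: M) (metis inner_commute)
      also have "\<dots> = M x' (M x a) \<bullet> b" by (rule sa[OF MS b, symmetric])
      finally show ?thesis .
    qed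
    moreover have "M x (M x' a) - M x' (M x a) \<in> ?S"
      by (intro subspace_diff sub MS)
    ultimately have "(M x (M x' a) - M x' (M x a)) \<bullet> (M x (M x' a) - M x' (M x a)) = 0"
      by (metis inner_diff_left right_minus_eq)
    then show ?thesis by simp
  qed
  have lM: "linear (M x)" for x unfolding M_def by (rule linear_compose[OF lg lin])
  have "?S \<noteq> {0}" using surj[of x1 y1] nz by force
  then obtain c l where c: "c \<in> ?S" "c \<noteq> 0" and l: "\<And>x. M x c = l x *\<^sub>R c"
    using commuting_selfadjoint_common_eigenvector[where M = M, OF lM sub _ image_subsetI[OF MS] sa comm]
    by metis
  have "c \<bullet> v x y = l x * (c \<bullet> v x0 y)" for x y
    using sa[OF c(1), of "v x0 y" x] by (simp add: l M)
  moreover obtain y where "c = v x0 y" using c by blast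
  then have "c \<bullet> v x0 y \<noteq> 0" using c by simp
  ultimately show ?thesis
    by (intro exI[of _ c] exI[of _ l] exI[of _ "\<lambda>y. c \<bullet> v x0 y"]) blast
qed

lemma product_functional_exists:
  fixes v :: "'a::euclidean_space \<Rightarrow> 'b::euclidean_space \<Rightarrow> 'e::euclidean_space"
  assumes bil: "bilinear v"
    and sym: "\<And>x y x' y'. v x y \<bullet> v x' y' = v x y' \<bullet> v x' y"
    and dim3: "dim (range (\<lambda>(x, y). v x y)) \<le> 3"
    and nz: "v x1 y1 \<noteq> 0"
  shows "\<exists>c \<alpha> \<beta>. (\<forall>x y. c \<bullet> v x y = \<alpha> x * \<beta> y) \<and> (\<exists>x y. c \<bullet> v x y \<noteq> 0)"
proof -
  have lin: "linear (v x)" "linear (\<lambda>x. v x y)" for x y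
    using bil by (simp_all add: bilinear_def)
  obtain x0 where x0: "\<And>x y. v x0 y = 0 \<Longrightarrow> v x y = 0"
    using generic_kernel[OF bil sym] by metis
  have bil': "bilinear (\<lambda>y x. v x y)" using bil by (simp add: bilinear_def)
  have sym': "v x y \<bullet> v x' y' = v x' y \<bullet> v x y'" for x y x' y'
    using sym[of x y x' y'] by (simp add: inner_commute)
  obtain y0 where y0: "\<And>x y. v x y0 = 0 \<Longrightarrow> v x y = 0"
    using generic_kernel[OF bil' sym'] by metis
  let ?G = "range (\<lambda>(x, y). v x y)"
  have G: "v x y \<in> ?G" for x y by force
  consider "\<And>x y. v x y \<in> range (v x0)" | "\<And>x y. v x y \<in> range (\<lambda>x. v x y0)"
    | x2 y2 x3 y3 where "v x2 y2 \<notin> range (v x0)" "v x3 y3 \<notin> range (\<lambda>x. v x y0)" by blast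
  then show ?thesis
  proof cases
    case 1
    then show ?thesis using product_functional_if_surjective[OF bil sym x0 _ nz] by blast
  next
    case 2
    obtain c \<alpha> \<beta> where "\<And>x y. c \<bullet> v x y = \<alpha> y * \<beta> x" "\<exists>x y. c \<bullet> v x y \<noteq> 0"
      using product_functional_if_surjective[OF bil' sym' y0 2 nz] by blast
    then show ?thesis by (metis mult.commute)
  next
    case 3
    let ?U = "range (\<lambda>x. v x y0)"
    have subU: "subspace ?U" using linear_subspace_image[OF lin(2) subspace_UNIV] .
    have "?U \<subseteq> span ?G" using G span_base by blast
    moreover have "v x3 y3 \<in> span ?G" using G by (rule span_base)
    then have "?U \<noteq> span ?G" using 3(2) by metis
    \<comment> \<open>The dimension bound enters here: a proper subspace of \<open>span ?G\<close>
      has dimension at most 2.\<close>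
    ultimately have "dim ?U < dim (span ?G)"
      using subspace_dim_equal[OF subU subspace_span] by (metis not_le)
    then have dimU: "dim ?U \<le> 2" using dim3 by simp
    define u0 where "u0 = v x0 y0"
    have u0: "u0 \<noteq> 0" using y0 x0 nz unfolding u0_def by metis
    then obtain B where B: "{u0} \<subseteq> B" "B \<subseteq> ?U" "independent B" "?U \<subseteq> span B"
      using maximal_independent_subset_extend[of "{u0}" ?U] by (auto simp: u0_def)
    have finB: "finite B" using B(3) by (rule independent_imp_finite)
    have "card B = dim ?U" using B by (intro basis_card_eq_dim)
    then have "card (B - {u0}) \<le> Suc 0" using B(1) dimU finB by simp
    then have "\<forall>a\<in>B - {u0}. \<forall>b\<in>B - {u0}. a = b"
      using finB by (subst (asm) card_le_Suc0_iff_eq) auto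
    then obtain u1 where "B - {u0} \<subseteq> {u1}" by blast
    \<comment> \<open>If \<open>u1\<close> lies outside \<open>?U\<close>, then
      \<open>B = {u0}\<close> and \<open>u0\<close> itself serves as second vector.\<close>
    then have "\<exists>u1\<in>?U. B \<subseteq> {u0, u1}" using B(2) by (cases "u1 \<in> ?U") (auto simp: u0_def)
    then obtain z1 where "B \<subseteq> {u0, v z1 y0}" by auto
    then have U: "?U \<subseteq> span {u0, v z1 y0}" using B(4) span_mono by blast
    have "\<exists>a b. v x y0 = a *\<^sub>R u0 + b *\<^sub>R v z1 y0" for x
    proof -
      have "v x y0 \<in> span {u0, v z1 y0}" using U by blast
      then show ?thesis by (auto simp: span_insert span_singleton) (metis add.commute diff_add_cancel diff_eq_eq)
    qed
    then obtain a b where ab: "\<And>x. v x y0 = a x *\<^sub>R u0 + b x *\<^sub>R v z1 y0" by metis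
    \<comment> \<open>By the choice of \<open>y0\<close>, a linear relation between the maps
      \<open>v x\<close> that holds at \<open>y0\<close> holds at every \<open>y\<close>.\<close>
    have dec: "v x y = a x *\<^sub>R v x0 y + b x *\<^sub>R v z1 y" for x y
    proof -
      have "v (x - (a x *\<^sub>R x0 + b x *\<^sub>R z1)) y0 = 0"
        by (simp add: linear_diff[OF lin(2)] linear_add[OF lin(2)] linear_scale[OF lin(2)] ab[of x] u0_def)
      from y0[OF this, of y] show ?thesis
        by (simp add: linear_diff[OF lin(2)] linear_add[OF lin(2)] linear_scale[OF lin(2)])
    qed
    have "span (range (v x0)) = range (v x0)"
      using linear_subspace_image[OF lin(1) subspace_UNIV] by (simp add: span_eq_iff)
    moreover have "span (range (v x0)) \<subseteq> span ?G"
      using G by (intro span_mono) blast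
    moreover have "v x2 y2 \<in> span ?G" using G by (rule span_base)
    ultimately have "span (range (v x0)) \<subset> span ?G"
      using 3(1) by (metis psubsetI)
    \<comment> \<open>Orthogonality to the range of \<open>v x0\<close> removes the first term of
      \<open>dec\<close> and leaves a product; membership in \<open>span ?G\<close> keeps it from
      vanishing identically.\<close>
    then obtain c where c: "c \<noteq> 0" "c \<in> span ?G" "\<And>u. u \<in> span (range (v x0)) \<Longrightarrow> orthogonal c u"
      using orthogonal_to_subspace_exists_gen by metis
    have "c \<bullet> v x y = b x * (c \<bullet> v z1 y)" for x y
      using c(3)[of "v x0 y"] by (simp add: dec[of x] inner_add_right orthogonal_def span_base)
    moreover have "\<exists>x y. c \<bullet> v x y \<noteq> 0"
    proof (rule ccontr)
      assume "\<nexists>x y. c \<bullet> v x y \<noteq> 0"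
      then have "orthogonal c z" if "z \<in> span ?G" for z
        using that by (rule_tac orthogonal_to_span) (auto simp: orthogonal_def)
      then show False using c(1,2) orthogonal_self by metis
    qed
    ultimately show ?thesis
      by (intro exI[of _ c] exI[of _ b] exI[of _ "\<lambda>y. c \<bullet> v z1 y"]) blast
  qed
qed

section \<open>Positive definite combinations of 2 by 2 minors\<close>

lemma rank_eq_1_iff:
  fixes A :: "real^'n^'m"
  shows "rank A = 1 \<longleftrightarrow> A \<noteq> 0 \<and> (\<exists>a b. \<forall>i j. A $ i $ j = a i * b j)"
proof (intro iffI conjI)
  assume r: "rank A = 1"
  show "A \<noteq> 0" using r by auto
  have "dim (range (\<lambda>x. A *v x)) = 1" using r by (simp add: rank_dim_range)
  then obtain u where u: "range (\<lambda>x. A *v x) \<subseteq> span {u}"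
    using basis_exists[of "range (\<lambda>x. A *v x)"] by (metis card_1_singletonE)
  have "\<exists>t. \<forall>i. A $ i $ j = u $ i * t" for j
  proof -
    have "A *v axis j 1 \<in> span {u}" using u by blast
    then obtain t where "A *v axis j 1 = t *\<^sub>R u" by (auto simp: span_singleton)
    then have "\<forall>i. A $ i $ j = u $ i * t"
      by (auto simp: matrix_vector_mult_basis column_def vec_eq_iff mult.commute)
    then show ?thesis ..
  qed
  then show "\<exists>a b. \<forall>i j. A $ i $ j = a i * b j" by metis
next
  assume "A \<noteq> 0 \<and> (\<exists>a b. \<forall>i j. A $ i $ j = a i * b j)"
  then obtain a b where nz: "A \<noteq> 0" and ab: "\<And>i j. A $ i $ j = a i * b j" by blast
  have "A *v x \<in> span {\<chi> i. a i}" for x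
  proof -
    have "A *v x = (\<Sum>j\<in>UNIV. b j * x $ j) *\<^sub>R (\<chi> i. a i)"
      by (simp add: vec_eq_iff matrix_vector_mult_def ab sum_distrib_left mult_ac)
    then show ?thesis by (simp add: span_base span_scale)
  qed
  then have "dim (range (\<lambda>x. A *v x)) \<le> card {\<chi> i. a i}"
    by (intro dim_le_card) auto
  moreover have "dim (range (\<lambda>x. A *v x)) \<noteq> 0"
    using nz matrix_eq[of A 0] by (auto simp: dim_eq_0)
  ultimately have "dim (range (\<lambda>x. A *v x)) = 1" by (simp del: dim_eq_0)
  then show "rank A = 1" by (simp add: rank_dim_range)
qed

text \<open>The components run over all index quadruples, so each minor occurs with both signs and
  degenerate ones vanish.\<close>

definition minors2 :: "real^'n^'m \<Rightarrow> real^('m \<times> 'm \<times> 'n \<times> 'n)" where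
  "minors2 X = (\<chi> p. case p of (i, k, j, l) \<Rightarrow> X $ i $ j * X $ k $ l - X $ i $ l * X $ k $ j)"

lemma minors2_nth [simp]:
  "minors2 X $ (i, k, j, l) = X $ i $ j * X $ k $ l - X $ i $ l * X $ k $ j"
  by (simp add: minors2_def)

lemma minors2_scaleR: "minors2 (t *\<^sub>R X) = t\<^sup>2 *\<^sub>R minors2 X"
  by (auto simp: vec_eq_iff power2_eq_square algebra_simps)

lemma continuous_on_minors2: "continuous_on S minors2"
  unfolding minors2_def by (intro continuous_intros) (auto simp: case_prod_unfold intro!: continuous_intros)

section \<open>From vanishing sums of minors to a rank-one matrix\<close>

lemma sum_sum_product:
  fixes f :: "'i \<Rightarrow> 'b \<Rightarrow> 'r::semiring_0"
  shows "(\<Sum>i\<in>I. (\<Sum>b\<in>B. f i b) * (\<Sum>d\<in>D. g i d)) = (\<Sum>b\<in>B. \<Sum>d\<in>D. \<Sum>i\<in>I. f i b * g i d)"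
proof -
  have "(\<Sum>i\<in>I. (\<Sum>b\<in>B. f i b) * (\<Sum>d\<in>D. g i d)) = (\<Sum>b\<in>B. \<Sum>i\<in>I. \<Sum>d\<in>D. f i b * g i d)"
    unfolding sum_product by (rule sum.swap)
  also have "\<dots> = (\<Sum>b\<in>B. \<Sum>d\<in>D. \<Sum>i\<in>I. f i b * g i d)"
    by (intro sum.cong refl sum.swap)
  finally show ?thesis .
qed

text \<open>Since \<open>c \<bullet> v x y = x \<bullet> (F c *v y)\<close>, a functional
  \<open>c\<close> for which this is a nonzero product makes \<open>F c\<close> an outer product,
  and \<open>F c\<close> lies in \<open>K\<close>.\<close>

lemma rank_1_if_sum_minors2_eq_0:
  fixes Y :: "'i::finite \<Rightarrow> real^'n^'m"
  assumes sub: "subspace K" and dim: "dim K \<le> 3" and YK: "\<And>i. Y i \<in> K"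
    and sum0: "(\<Sum>i\<in>UNIV. minors2 (Y i)) = 0" and nz: "Y i0 \<noteq> 0"
  shows "\<exists>C\<in>K. rank C = 1"
proof -
  define F where "F c = (\<Sum>i\<in>UNIV. c $ i *\<^sub>R Y i)" for c :: "real^'i"
  define v :: "real^'m \<Rightarrow> real^'n \<Rightarrow> real^'i" where "v x y = (\<chi> i. x \<bullet> (Y i *v y))" for x y
  have FK: "F c \<in> K" for c
    unfolding F_def by (intro subspace_sum[OF sub] subspace_scale[OF sub] YK)
  have linF: "linear F"
    by (rule linearI) (simp_all add: F_def scaleR_add_left sum.distrib scaleR_sum_right)
  have Fv: "c \<bullet> v x y = x \<bullet> (F c *v y)" for c x y
  proof -
    have "(F c *v y) $ a = (\<Sum>i\<in>UNIV. c $ i *\<^sub>R (Y i *v y)) $ a" for a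
    proof -
      have "(F c *v y) $ a = (\<Sum>b\<in>UNIV. \<Sum>i\<in>UNIV. c $ i * Y i $ a $ b * y $ b)"
        by (simp add: F_def matrix_vector_mult_def sum_distrib_right)
      also have "\<dots> = (\<Sum>i\<in>UNIV. \<Sum>b\<in>UNIV. c $ i * Y i $ a $ b * y $ b)"
        by (rule sum.swap)
      finally show ?thesis by (simp add: matrix_vector_mult_def sum_distrib_left mult.assoc)
    qed
    then have "F c *v y = (\<Sum>i\<in>UNIV. c $ i *\<^sub>R (Y i *v y))" by (simp add: vec_eq_iff)
    then show ?thesis by (simp add: inner_sum_right inner_vec_def[of c] v_def)
  qed
  have bil: "bilinear v"
    unfolding bilinear_def
    by (auto intro!: linearI simp: v_def vec_eq_iff inner_add_left inner_add_right
        matrix_vector_right_distrib matrix_vector_mult_scaleR)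
  \<comment> \<open>The vanishing sum is exchange symmetry on basis vectors; \<open>comp\<close> and
    \<open>sym\<close> extend it bilinearly.\<close>
  have minor0: "(\<Sum>i\<in>UNIV. Y i $ a $ b * Y i $ c $ d) = (\<Sum>i\<in>UNIV. Y i $ a $ d * Y i $ c $ b)" for a b c d
    using arg_cong[OF sum0, of "\<lambda>z. z $ (a, c, b, d)"] by (simp add: sum_subtractf)
  have comp: "(\<Sum>i\<in>UNIV. (Y i *v y) $ a * (Y i *v y') $ c) =
      (\<Sum>i\<in>UNIV. (Y i *v y') $ a * (Y i *v y) $ c)" for y y' a c
  proof -
    have "(\<Sum>i\<in>UNIV. (Y i *v y) $ a * (Y i *v y') $ c) =
        (\<Sum>b\<in>UNIV. \<Sum>d\<in>UNIV. \<Sum>i\<in>UNIV. (Y i $ a $ b * y $ b) * (Y i $ c $ d * y' $ d))"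
      by (simp add: matrix_vector_mult_def sum_sum_product)
    also have "\<dots> = (\<Sum>b\<in>UNIV. \<Sum>d\<in>UNIV. y $ b * y' $ d * (\<Sum>i\<in>UNIV. Y i $ a $ b * Y i $ c $ d))"
      by (simp add: sum_distrib_left mult_ac)
    also have "\<dots> = (\<Sum>b\<in>UNIV. \<Sum>d\<in>UNIV. y $ b * y' $ d * (\<Sum>i\<in>UNIV. Y i $ a $ d * Y i $ c $ b))"
      by (simp only: minor0)
    also have "\<dots> = (\<Sum>b\<in>UNIV. \<Sum>d\<in>UNIV. \<Sum>i\<in>UNIV. (Y i $ a $ d * y' $ d) * (Y i $ c $ b * y $ b))"
      by (simp add: sum_distrib_left mult_ac)
    also have "\<dots> = (\<Sum>i\<in>UNIV. (Y i *v y') $ a * (Y i *v y) $ c)"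
      by (subst sum.swap) (simp add: matrix_vector_mult_def sum_sum_product)
    finally show ?thesis .
  qed
  have sym: "v x y \<bullet> v x' y' = v x y' \<bullet> v x' y" for x y x' y'
  proof -
    have expand: "v x y \<bullet> v x' y' = (\<Sum>a\<in>UNIV. \<Sum>c\<in>UNIV. x $ a * x' $ c *
        (\<Sum>i\<in>UNIV. (Y i *v y) $ a * (Y i *v y') $ c))" for y y'
      by (simp add: v_def inner_vec_def sum_sum_product) (simp add: sum_distrib_left mult_ac)
    show ?thesis unfolding expand by (simp only: comp[of y _ y'])
  qed
  let ?G = "range (\<lambda>(x, y). v x y)"
  \<comment> \<open>If \<open>F c = 0\<close>, then \<open>c\<close> is orthogonal to all values of
    \<open>v\<close>. Injectivity bounds the dimension of the span of these values by
    \<open>dim K\<close>.\<close>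
  have "inj_on F (span ?G)"
  proof (rule linear_inj_on_iff_eq_0[OF linF, THEN iffD2])
    show "subspace (span ?G)" by simp
    show "\<forall>c\<in>span ?G. F c = 0 \<longrightarrow> c = 0"
    proof (intro ballI impI)
      fix c assume c: "c \<in> span ?G" "F c = 0"
      have "orthogonal c z" if "z \<in> ?G" for z
        using that c(2) by (auto simp: orthogonal_def Fv)
      then have "orthogonal c c" by (rule orthogonal_to_span[OF c(1)])
      then show "c = 0" by (simp add: orthogonal_self)
    qed
  qed
  then have "dim ?G = dim (F ` ?G)"
    using dim_image_eq[OF linF] by metis
  also have "\<dots> \<le> dim K" using FK by (intro dim_subset) blast
  finally have dimG: "dim ?G \<le> 3" using dim by simp
  have "\<exists>x y. v x y \<noteq> 0"
  proof -
    obtain a b where "Y i0 $ a $ b \<noteq> 0" using nz by (auto simp: vec_eq_iff)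
    then have "v (axis a 1) (axis b 1) $ i0 \<noteq> 0"
      by (simp add: v_def inner_axis' matrix_vector_mult_basis column_def)
    then show ?thesis by (metis zero_index)
  qed
  then obtain x1 y1 where "v x1 y1 \<noteq> 0" by blast
  then obtain c \<alpha> \<beta> where c: "\<And>x y. c \<bullet> v x y = \<alpha> x * \<beta> y" and c_nz: "\<exists>x y. c \<bullet> v x y \<noteq> 0"
    using product_functional_exists[OF bil sym dimG] by blast
  have "F c \<noteq> 0" using c_nz by (metis Fv inner_zero_right matrix_vector_mult_0)
  moreover have "F c $ i $ j = \<alpha> (axis i 1) * \<beta> (axis j 1)" for i j
    using c[of "axis i 1" "axis j 1"] by (simp add: Fv inner_axis' matrix_vector_mult_basis column_def)
  ultimately have "rank (F c) = 1"
    unfolding rank_eq_1_iff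
    by (intro conjI exI[of _ "\<lambda>i. \<alpha> (axis i 1)"] exI[of _ "\<lambda>j. \<beta> (axis j 1)"]) auto
  then show ?thesis using FK by blast
qed

text \<open>As \<open>minors2\<close> is quadratic, the weights of a convex combination can be
  absorbed into the matrices as square roots, giving a vanishing sum of minors.\<close>

lemma zero_notin_convex_hull_minors2:
  fixes K :: "(real^'n^'m) set"
  assumes sub: "subspace K" and dim: "dim K \<le> 3" and no1: "\<And>C. C \<in> K \<Longrightarrow> rank C \<noteq> 1"
  shows "0 \<notin> convex hull (minors2 ` (K \<inter> sphere 0 1))"
proof
  let ?C = "minors2 ` (K \<inter> sphere 0 1)"
  assume "0 \<in> convex hull ?C"
  then obtain s u where s: "finite s" "s \<subseteq> ?C" and card: "card s \<le> DIM(real^('m \<times> 'm \<times> 'n \<times> 'n)) + 1"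
    and u: "\<And>z. z \<in> s \<Longrightarrow> 0 \<le> u z" "sum u s = 1" and sum0: "(\<Sum>z\<in>s. u z *\<^sub>R z) = 0"
    unfolding convex_hull_caratheodory by blast
  have "card s \<le> card (UNIV :: ('m \<times> 'm \<times> 'n \<times> 'n) option set)"
    using card by (simp add: card_UNIV_option)
  then obtain h :: "_ \<Rightarrow> ('m \<times> 'm \<times> 'n \<times> 'n) option" where h: "inj_on h s"
    using card_le_inj[OF s(1) finite] by blast
  have "\<forall>z\<in>s. \<exists>x. x \<in> K \<inter> sphere 0 1 \<and> minors2 x = z"
    using s(2) by blast
  then obtain X where X: "\<And>z. z \<in> s \<Longrightarrow> X z \<in> K \<inter> sphere 0 1 \<and> minors2 (X z) = z"
    by metis
  define Y where "Y i = (if i \<in> h ` s then sqrt (u (the_inv_into s h i)) *\<^sub>R X (the_inv_into s h i) else 0)" for i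
  have Yh: "Y (h z) = sqrt (u z) *\<^sub>R X z" if "z \<in> s" for z
    using that h by (simp add: Y_def the_inv_into_f_f)
  have "(\<Sum>i\<in>UNIV. minors2 (Y i)) = (\<Sum>i\<in>h ` s. minors2 (Y i))"
    using minors2_scaleR[of 0 0] by (intro sum.mono_neutral_right) (auto simp: Y_def)
  also have "\<dots> = (\<Sum>z\<in>s. minors2 (Y (h z)))"
    by (simp add: sum.reindex[OF h])
  also have "\<dots> = (\<Sum>z\<in>s. u z *\<^sub>R z)"
    by (intro sum.cong refl) (simp add: Yh minors2_scaleR u X)
  finally have "(\<Sum>i\<in>UNIV. minors2 (Y i)) = 0" using sum0 by simp
  moreover have "Y i \<in> K" for i
    using X h sub by (auto simp: Y_def the_inv_into_f_f subspace_0 intro!: subspace_scale)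
  moreover obtain z where "z \<in> s" "u z \<noteq> 0" using u(2) by (metis sum.neutral zero_neq_one)
  then have "Y (h z) \<noteq> 0" using X[of z] u(1)[of z] by (auto simp: Yh)
  ultimately show False
    using rank_1_if_sum_minors2_eq_0[OF sub dim, of Y] no1 by blast
qed

text \<open>A hyperplane strictly separating 0 from the compact convex hull has normal
  \<open>w\<close>; homogeneity of degree 2 extends positivity from the sphere to
  \<open>K\<close>.\<close>

lemma positive_definite_minors2:
  fixes K :: "(real^'n^'m) set"
  assumes sub: "subspace K" and dim: "dim K \<le> 3" and no1: "\<And>C. C \<in> K \<Longrightarrow> rank C \<noteq> 1"
  obtains w where "\<And>X. X \<in> K \<Longrightarrow> X \<noteq> 0 \<Longrightarrow> w \<bullet> minors2 X > 0"
proof -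
  let ?C = "minors2 ` (K \<inter> sphere 0 1)"
  have "compact (convex hull ?C)"
    using closed_subspace[OF sub]
    by (intro compact_convex_hull compact_continuous_image continuous_on_minors2) (simp add: closed_Int_compact)
  then obtain w b where w: "0 < b" "\<And>z. z \<in> convex hull ?C \<Longrightarrow> w \<bullet> z > b"
    using separating_hyperplane_closed_0[of "convex hull ?C"] convex_convex_hull
      zero_notin_convex_hull_minors2[OF assms] compact_imp_closed by metis
  have "w \<bullet> minors2 X > 0" if X: "X \<in> K" "X \<noteq> 0" for X
  proof -
    have "(1 / norm X) *\<^sub>R X \<in> K \<inter> sphere 0 1" using X sub by (simp add: subspace_scale)
    then have "w \<bullet> minors2 ((1 / norm X) *\<^sub>R X) > 0"
      using w hull_inc[of _ ?C] by (meson imageI less_trans)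
    then show ?thesis using X by (simp add: minors2_scaleR zero_less_mult_iff power2_eq_square zero_less_divide_iff)
  qed
  then show thesis using that by blast
qed

section \<open>Polyconvex measures\<close>

text \<open>The complement of the support is a union of null balls, and by Lindelof countably many
  of them suffice.\<close>

lemma AE_in_Spt:
  fixes \<nu> :: "'a::{metric_space, second_countable_topology} measure"
  assumes "sets \<nu> = sets borel"
  shows "AE x in \<nu>. x \<in> Spt \<nu>"
proof -
  define F where "F = {ball x e | x e. emeasure \<nu> (ball x e) = 0}"
  have "open S" if "S \<in> F" for S using that by (auto simp: F_def)
  then obtain F' where F': "F' \<subseteq> F" "countable F'" "\<Union>F' = \<Union>F"
    using Lindelof by metis
  have "(\<Union>S\<in>F'. S) \<in> null_sets \<nu>"
    using F' assms by (intro null_sets_UN') (auto simp: null_sets_def F_def)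
  moreover have "x \<in> \<Union>F" if "x \<notin> Spt \<nu>" for x
    using that centre_in_ball unfolding Spt_def F_def by blast
  then have "{x \<in> space \<nu>. x \<notin> Spt \<nu>} \<subseteq> (\<Union>S\<in>F'. S)"
    using F'(3) by auto
  ultimately show ?thesis by (rule AE_I')
qed

section \<open>Determinants of order one and two, and of outer products\<close>

lemma det_k_Suc_0: "det_k (Suc 0) M = M 0 0"
proof -
  have "{p::nat \<Rightarrow> nat. p permutes {..<Suc 0}} = {id}"
    by (auto simp: lessThan_Suc)
  then show ?thesis by (simp add: det_k_def sign_id)
qed

lemma det_k_2: "det_k 2 M = M 0 0 * M 1 1 - M 0 1 * M 1 0"
proof -
  have "{..<2::nat} = {0, 1}" by auto
  then have "{p. p permutes {..<2::nat}} = {id, Transposition.transpose 0 1}"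
    by (auto simp: permutes_doubleton_iff)
  moreover have "id \<noteq> Transposition.transpose (0::nat) 1" by (metis id_apply transpose_apply_first zero_neq_one)
  ultimately show ?thesis
    by (simp add: det_k_def sign_id sign_swap_id numeral_2_eq_2 lessThan_Suc mult.commute)
qed

text \<open>Composition with a fixed transposition pairs permutations of opposite sign.\<close>

lemma sum_sign_permutes_eq_0:
  fixes k :: nat
  assumes "k \<ge> 2"
  shows "(\<Sum>p | p permutes {..<k}. of_int (sign p) :: real) = 0"
proof -
  let ?t = "Transposition.transpose (0::nat) 1"
  have t: "?t permutes {..<k}" using assms by (intro permutes_swap_id) auto
  have tt: "?t \<circ> (?t \<circ> p) = p" for p :: "nat \<Rightarrow> nat"
    by (simp add: comp_assoc[symmetric])
  have "(\<Sum>p | p permutes {..<k}. of_int (sign p) :: real) =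
      (\<Sum>p | p permutes {..<k}. - of_int (sign p))"
  proof (rule sum.reindex_bij_witness[where i = "\<lambda>p. ?t \<circ> p" and j = "\<lambda>p. ?t \<circ> p"])
    fix p assume "p \<in> {p. p permutes {..<k}}"
    then have p: "p permutes {..<k}" by simp
    show "?t \<circ> p \<in> {p. p permutes {..<k}}" using permutes_compose[OF p t] by simp
    then show "- of_int (sign (?t \<circ> p)) = (of_int (sign p) :: real)"
      using permutes_imp_permutation[OF finite_lessThan p]
      by (simp add: sign_compose permutation_swap_id sign_swap_id)
  qed (use tt permutes_compose[OF _ t] in auto)
  then show ?thesis by (simp add: sum_negf)
qed

text \<open>Every permutation contributes the same product, so only the sum of the signs
  remains.\<close>

lemma det_k_product_eq_0:
  assumes "k \<ge> 2"
  shows "det_k k (\<lambda>i j. a i * b j) = 0"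
proof -
  have "(\<Prod>i<k. a i * b (p i)) = (\<Prod>i<k. a i) * (\<Prod>i<k. b i)" if "p permutes {..<k}" for p
    using prod.permute[OF that, of b] by (simp add: prod.distrib comp_def)
  then have "det_k k (\<lambda>i j. a i * b j) =
      (\<Sum>p | p permutes {..<k}. of_int (sign p)) * ((\<Prod>i<k. a i) * (\<Prod>i<k. b i))"
    unfolding det_k_def sum_distrib_right by (intro sum.cong) auto
  then show ?thesis by (simp add: sum_sign_permutes_eq_0[OF assms])
qed

text \<open>Minors of order one are odd, and all higher ones vanish at both \<open>C\<close> and
  \<open>- C\<close>.\<close>

lemma minors_uminus_product:
  fixes C :: "real^'n::{finite,linorder}^'m::{finite,linorder}"
  assumes "\<And>i j. C $ i $ j = a i * b j"
  shows "minors (- C) = - minors C"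
proof -
  have "minor (- C) I J = - minor C I J" if "card I \<ge> 1" for I J
  proof (cases "card I = 1")
    case True
    then show ?thesis by (simp add: minor_def det_k_Suc_0)
  next
    case False
    with that have k: "card I \<ge> 2" by simp
    show ?thesis
      using det_k_product_eq_0[OF k, of "\<lambda>i. a (sorted_list_of_set I ! i)" "\<lambda>j. b (sorted_list_of_set J ! j)"]
        det_k_product_eq_0[OF k, of "\<lambda>i. - a (sorted_list_of_set I ! i)" "\<lambda>j. b (sorted_list_of_set J ! j)"]
      by (simp add: minor_def assms)
  qed
  then show ?thesis by (simp add: minors_def vec_eq_iff)
qed

section \<open>Minors and barycentres of polyconvex measures\<close>

lemma continuous_on_minors: "continuous_on S minors"
proof -
  have "continuous_on S (\<lambda>X. minors X $ IJ)" for IJ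
  proof (cases "card (fst IJ) = card (snd IJ) \<and> card (fst IJ) \<ge> 1")
    case True
    then have "(\<lambda>X. minors X $ IJ) = (\<lambda>X. minor X (fst IJ) (snd IJ))"
      by (simp add: minors_def)
    then show ?thesis
      by (simp only: minor_def det_k_def) (intro continuous_intros)
  next
    case False
    then show ?thesis by (simp only: minors_def vec_lambda_beta if_False continuous_on_const)
  qed
  then show ?thesis using continuous_on_vec_lambda[of S "\<lambda>IJ X. minors X $ IJ"] by simp
qed

text \<open>Bridges the two encodings: sorting the indices costs the sign \<open>s\<close>, and
  repeated indices give \<open>s = 0\<close>.\<close>

lemma minors2_nth_eq_minors_nth:
  "\<exists>IJ s. \<forall>X :: real^'n::{finite,linorder}^'m::{finite,linorder}. minors2 X $ p = s * minors X $ IJ"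
proof -
  obtain i k j l where p: "p = (i, k, j, l)" by (cases p)
  have *: "minors X $ ({i, k}, {j, l}) = minors2 X $ (i, k, j, l)"
    if "i < k" "j < l" for X :: "real^'n::{finite,linorder}^'m::{finite,linorder}" and i k :: 'm and j l :: 'n
  proof -
    have "sorted_list_of_set {i, k} = [i, k]" "sorted_list_of_set {j, l} = [j, l]"
      using that by (auto simp: sorted_list_of_set_insert_remove)
    moreover have "card {i, k} = 2" "card {j, l} = 2" using that by auto
    ultimately show ?thesis by (simp add: minors_def minor_def det_k_2)
  qed
  consider "i = k \<or> j = l" | "i < k" "j < l" | "k < i" "j < l" | "i < k" "l < j" | "k < i" "l < j"
    by (meson linorder_cases)
  then show ?thesis
  proof cases
    case 1
    then show ?thesis by (intro exI[of _ undefined] exI[of _ 0]) (auto simp: p)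
  next
    case 2
    then show ?thesis
      by (intro exI[of _ "({i, k}, {j, l})"] exI[of _ 1]) (simp add: p *)
  next
    case 3
    then show ?thesis
      by (intro exI[of _ "({k, i}, {j, l})"] exI[of _ "-1"]) (simp add: p * algebra_simps)
  next
    case 4
    then show ?thesis
      by (intro exI[of _ "({i, k}, {l, j})"] exI[of _ "-1"]) (simp add: p * algebra_simps)
  next
    case 5
    then show ?thesis
      by (intro exI[of _ "({k, i}, {l, j})"] exI[of _ 1]) (simp add: p * algebra_simps)
  qed
qed

text \<open>A minor and its negative are both polyconvex, so Jensen's inequality holds in both
  directions.\<close>

lemma Mpc_minors2:
  fixes \<nu> :: "(real^'n::{finite,linorder}^'m::{finite,linorder}) measure"
  assumes "\<nu> \<in> Mpc K"
  shows "integrable \<nu> (\<lambda>X. minors2 X $ p)"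
    and "integral\<^sup>L \<nu> (\<lambda>X. minors2 X $ p) = minors2 (integral\<^sup>L \<nu> (\<lambda>X. X)) $ p"
proof -
  let ?Z = "integral\<^sup>L \<nu> (\<lambda>X. X)"
  have int: "integrable \<nu> (\<lambda>X. minors X $ IJ)" for IJ
    using assms by (intro integrable_bounded_linear[OF bounded_linear_vec_nth]) (simp add: Mpc_def)
  have jensen: "f ?Z \<le> integral\<^sup>L \<nu> f" if "polyconvex f" "integrable \<nu> f" for f
    using assms that by (auto simp: Mpc_def)
  have pc: "polyconvex (\<lambda>X. s * minors X $ IJ)" for IJ and s :: real
    unfolding polyconvex_def
    by (intro exI[of _ "\<lambda>z. s * z $ IJ"]) (auto simp: convex_on_def algebra_simps)
  have minors: "integral\<^sup>L \<nu> (\<lambda>X. minors X $ IJ) = minors ?Z $ IJ" for IJ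
    using jensen[OF pc[of 1 IJ]] jensen[OF pc[of "-1" IJ]] int[of IJ] by simp
  obtain IJ s where "\<And>X :: real^'n::{finite,linorder}^'m::{finite,linorder}. minors2 X $ p = s * minors X $ IJ"
    using minors2_nth_eq_minors_nth by metis
  then show "integrable \<nu> (\<lambda>X. minors2 X $ p)"
    and "integral\<^sup>L \<nu> (\<lambda>X. minors2 X $ p) = minors2 ?Z $ p"
    using int minors by simp_all
qed

text \<open>The component \<open>z\<close> of the barycentre orthogonal to \<open>K\<close>
  satisfies \<open>z \<bullet> X = 0\<close> almost everywhere; integration gives
  \<open>z \<bullet> z = 0\<close>.\<close>

lemma Mpc_barycentre_in:
  fixes \<nu> :: "(real^'n::{finite,linorder}^'m::{finite,linorder}) measure"
  assumes \<nu>: "\<nu> \<in> Mpc K" and sub: "subspace K"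
  shows "AE X in \<nu>. X \<in> K" and "integral\<^sup>L \<nu> (\<lambda>X. X) \<in> K"
proof -
  let ?Z = "integral\<^sup>L \<nu> (\<lambda>X. X)"
  show AE: "AE X in \<nu>. X \<in> K"
    using AE_in_Spt[of \<nu>] \<nu> by (auto simp: Mpc_def)
  obtain k z where k: "k \<in> span K" "\<And>w. w \<in> span K \<Longrightarrow> orthogonal z w" "?Z = k + z"
    using orthogonal_subspace_decomp_exists[of K ?Z] by metis
  have kK: "k \<in> K" using k(1) sub by (simp add: span_eq_iff[THEN iffD2])
  have "z \<bullet> ?Z = integral\<^sup>L \<nu> (\<lambda>X. z \<bullet> X)"
    using \<nu> by (intro integral_inner_right[symmetric]) (simp add: Mpc_def)
  also have "\<dots> = 0"
  proof (rule integral_eq_zero_AE)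
    show "AE X in \<nu>. z \<bullet> X = 0"
      using AE by eventually_elim (use k(2) span_base in \<open>auto simp: orthogonal_def\<close>)
  qed
  finally have "z \<bullet> z = 0"
    using k(2)[OF k(1)] by (simp add: k(3) inner_add_right orthogonal_def)
  then show "?Z \<in> K" using k(3) kK by simp
qed

lemma AE_eq_const_imp_return:
  fixes \<nu> :: "'a::t1_space measure"
  assumes "prob_space \<nu>" and s: "sets \<nu> = sets borel" and AE: "AE x in \<nu>. x = c"
  shows "\<nu> = return borel c"
proof (rule measure_eqI)
  interpret prob_space \<nu> by fact
  show "sets \<nu> = sets (return borel c)" using s by simp
  fix A assume A: "A \<in> sets \<nu>"
  show "emeasure \<nu> A = emeasure (return borel c) A"
  proof (cases "c \<in> A")
    case True
    have "AE x in \<nu>. x \<in> A" using AE by eventually_elim (use True in auto)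
    then show ?thesis using A s True by (simp add: emeasure_eq_1_AE)
  next
    case False
    have "AE x in \<nu>. x \<notin> A" using AE by eventually_elim (use False in auto)
    then show ?thesis using A s False by (simp add: emeasure_eq_AE[of A "{}"])
  qed
qed

section \<open>Absence of rank-one matrices forces Dirac measures\<close>

lemma Mpc_Dirac:
  fixes K :: "(real^'n::{finite,linorder}^'m::{finite,linorder}) set"
  assumes sub: "subspace K" and dim: "dim K \<le> 3" and no1: "\<And>C. C \<in> K \<Longrightarrow> rank C \<noteq> 1"
    and \<nu>: "\<nu> \<in> Mpc K"
  shows "\<nu> = return borel (integral\<^sup>L \<nu> (\<lambda>X. X))"
proof -
  define Z where "Z = integral\<^sup>L \<nu> (\<lambda>X. X)"
  interpret prob_space \<nu> using \<nu> by (simp add: Mpc_def)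
  obtain w where w: "\<And>X. X \<in> K \<Longrightarrow> X \<noteq> 0 \<Longrightarrow> w \<bullet> minors2 X > 0"
    using positive_definite_minors2[OF sub dim no1] by metis
  have intX: "integrable \<nu> (\<lambda>X. X)" using \<nu> by (simp add: Mpc_def)
  have int1: "integrable \<nu> (\<lambda>X. X $ i $ j)" for i j
    by (intro integrable_bounded_linear[OF bounded_linear_compose[OF bounded_linear_vec_nth bounded_linear_vec_nth] intX])
  have Z1: "integral\<^sup>L \<nu> (\<lambda>X. X $ i $ j) = Z $ i $ j" for i j
    unfolding Z_def
    by (intro integral_bounded_linear[OF bounded_linear_compose[OF bounded_linear_vec_nth bounded_linear_vec_nth] intX])
  have comp: "integrable \<nu> (\<lambda>X. minors2 (X - Z) $ p)" "integral\<^sup>L \<nu> (\<lambda>X. minors2 (X - Z) $ p) = 0" for p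
  proof -
    obtain i k j l where p: "p = (i, k, j, l)" by (cases p)
    \<comment> \<open>The bracket is linear in \<open>X\<close> and integrates to twice the minor of
      \<open>Z\<close>, cancelling the other two terms.\<close>
    have expand: "minors2 (X - Z) $ p = minors2 X $ p + minors2 Z $ p
        - (X $ i $ j * Z $ k $ l + Z $ i $ j * X $ k $ l - X $ i $ l * Z $ k $ j - Z $ i $ l * X $ k $ j)" for X
      by (simp add: p algebra_simps)
    note int2 = Mpc_minors2(1)[OF \<nu>, of p]
    show "integrable \<nu> (\<lambda>X. minors2 (X - Z) $ p)"
      unfolding expand using int1 int2 by simp
    show "integral\<^sup>L \<nu> (\<lambda>X. minors2 (X - Z) $ p) = 0"
      unfolding expand using int1 int2 Mpc_minors2(2)[OF \<nu>, of p]
      by (simp add: Z1 prob_space Z_def[symmetric]) (simp add: p)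
  qed
  define q where "q X = w \<bullet> minors2 (X - Z)" for X
  have q: "q = (\<lambda>X. \<Sum>p\<in>UNIV. w $ p * minors2 (X - Z) $ p)"
    by (rule ext) (simp add: q_def inner_vec_def)
  have "integrable \<nu> q" and q0: "integral\<^sup>L \<nu> q = 0"
    unfolding q using comp by simp_all
  have AEK: "AE X in \<nu>. X - Z \<in> K"
    using Mpc_barycentre_in[OF \<nu> sub] unfolding Z_def[symmetric]
    by (auto elim!: eventually_mono intro: subspace_diff[OF sub])
  have m0: "minors2 (0 :: real^'n::{finite,linorder}^'m::{finite,linorder}) = 0"
    using minors2_scaleR[of 0 0] by simp
  have "AE X in \<nu>. 0 \<le> q X"
    using AEK
  proof eventually_elim
    case (elim X)
    then show ?case using w[of "X - Z"] m0 by (cases "X - Z = 0") (auto simp: q_def)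
  qed
  then have "AE X in \<nu>. q X = 0"
    using integral_nonneg_eq_0_iff_AE[OF \<open>integrable \<nu> q\<close>] q0 by blast
  with AEK have "AE X in \<nu>. X = Z"
  proof eventually_elim
    case (elim X)
    then show ?case using w[of "X - Z"] by (auto simp: q_def)
  qed
  then show ?thesis
    unfolding Z_def[symmetric] using \<nu> prob_space_axioms by (intro AE_eq_const_imp_return) (auto simp: Mpc_def)
qed

section \<open>A non-Dirac polyconvex measure from a rank-one matrix\<close>

lemma laminate_Mpc:
  fixes K :: "(real^'n::{finite,linorder}^'m::{finite,linorder}) set"
  assumes sub: "subspace K" and C: "C \<in> K" "rank C = 1"
  shows "\<exists>\<nu>\<in>Mpc K. \<forall>A. \<nu> \<noteq> return borel A"
proof -
  let ?p = "pmf_of_set {C, - C}"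
  \<comment> \<open>The pushforward along the identity replaces the discrete sigma-algebra of the
    \<open>pmf\<close> by the Borel one.\<close>
  define \<nu> where "\<nu> = distr (measure_pmf ?p) borel (\<lambda>X. X)"
  have nz: "C \<noteq> 0" and "\<exists>a b. \<forall>i j. C $ i $ j = a i * b j"
    using C(2) unfolding rank_eq_1_iff by auto
  then have m: "minors (- C) = - minors C" using minors_uminus_product by metis
  have m0: "minors (0 :: real^'n::{finite,linorder}^'m::{finite,linorder}) = 0"
    using minors_uminus_product[of "0 :: real^'n::{finite,linorder}^'m::{finite,linorder}" "\<lambda>_. 0" "\<lambda>_. 0"]
    by (simp add: vec_eq_iff)
  have ne: "C \<noteq> - C"
  proof
    assume "C = - C"
    then have "2 *\<^sub>R C = 0" by (simp add: scaleR_2 eq_neg_iff_add_eq_0)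
    then show False using nz by simp
  qed
  have card: "card {C, - C} = 2" using ne by (metis card_2_iff)
  have meas: "(\<lambda>X. X) \<in> measure_pmf ?p \<rightarrow>\<^sub>M borel" by simp
  have em: "emeasure \<nu> A = emeasure (measure_pmf ?p) A" if "A \<in> sets borel" for A
    using that by (simp add: \<nu>_def emeasure_distr)
  have integral: "integral\<^sup>L \<nu> f = (f C + f (- C)) /\<^sub>R 2" if "f \<in> borel_measurable borel"
    for f :: "real^'n::{finite,linorder}^'m::{finite,linorder} \<Rightarrow> 'c::{banach, second_countable_topology}"
  proof -
    have "integral\<^sup>L \<nu> f = (\<Sum>X\<in>{C, - C}. pmf ?p X *\<^sub>R f X)"
      unfolding \<nu>_def integral_distr[OF meas that]
      by (rule integral_measure_pmf) auto
    also have "\<dots> = pmf ?p C *\<^sub>R f C + pmf ?p (- C) *\<^sub>R f (- C)"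
      using ne by (subst sum.insert) auto
    finally show ?thesis by (simp add: card scaleR_add_right)
  qed
  have integrable: "integrable \<nu> f" if "f \<in> borel_measurable borel"
    for f :: "real^'n::{finite,linorder}^'m::{finite,linorder} \<Rightarrow> 'c::{banach, second_countable_topology}"
    unfolding \<nu>_def using that
    by (subst integrable_distr_eq[OF meas]) (auto intro!: integrable_measure_pmf_finite)
  have "Spt \<nu> \<subseteq> {C, - C}"
  proof
    fix X assume X: "X \<in> Spt \<nu>"
    show "X \<in> {C, - C}"
    proof (rule ccontr)
      assume "X \<notin> {C, - C}"
      then obtain e where e: "e > 0" "ball X e \<subseteq> - {C, - C}"
        using open_contains_ball[of "- {C, - C}"] by auto
      have "emeasure (measure_pmf ?p) (ball X e) = 0"
        using e(2) by (subst measure_pmf.emeasure_eq_measure) (auto simp: measure_pmf_zero_iff)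
      then show False using X e(1) em[of "ball X e"] by (auto simp: Spt_def)
    qed
  qed
  then have spt: "Spt \<nu> \<subseteq> K"
    using C(1) sub by (auto dest: subspace_neg)
  have zero: "integral\<^sup>L \<nu> (\<lambda>X. X) = 0"
    by (subst integral) auto
  have jensen: "f (integral\<^sup>L \<nu> (\<lambda>X. X)) \<le> integral\<^sup>L \<nu> f" if f: "polyconvex f" "integrable \<nu> f" for f
  proof -
    obtain g where g: "convex_on UNIV g" "\<And>X. f X = g (minors X)"
      using f(1) by (auto simp: polyconvex_def)
    \<comment> \<open>The minors of \<open>C\<close> and \<open>- C\<close> are opposite, so their
      midpoint is 0, the minors of the barycentre.\<close>
    have "g ((1/2) *\<^sub>R minors C + (1/2) *\<^sub>R minors (- C)) \<le> (1/2) * g (minors C) + (1/2) * g (minors (- C))"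
      using convex_onD[OF g(1), of "1/2" "minors C" "minors (- C)"] by simp
    then have "f 0 \<le> (f C + f (- C)) /\<^sub>R 2" by (simp add: g(2) m m0)
    moreover have "f \<in> borel_measurable borel"
      using borel_measurable_integrable[OF f(2)] by (simp add: \<nu>_def)
    ultimately show ?thesis by (simp add: integral zero)
  qed
  have "prob_space \<nu>"
    unfolding \<nu>_def by (intro measure_pmf.prob_space_distr meas)
  moreover have "sets \<nu> = sets borel" by (simp add: \<nu>_def)
  ultimately have "\<nu> \<in> Mpc K"
    unfolding Mpc_def using spt jensen
    by (auto intro!: integrable borel_measurable_continuous_onI continuous_on_minors)
  moreover have "\<nu> \<noteq> return borel A" for A
  proof
    assume "\<nu> = return borel A"
    \<comment> \<open>A Dirac measure gives \<open>{C}\<close> mass 0 or 1, whereas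
      \<open>\<nu>\<close> gives it mass 1/2.\<close>
    then have "measure \<nu> {C} = indicator {C} A" by (simp add: measure_return)
    moreover have "measure \<nu> {C} = 1 / 2"
      by (simp add: \<nu>_def measure_distr measure_pmf_single card)
    ultimately show False by (cases "A = C") auto
  qed
  ultimately show ?thesis by blast
qed

theorem theorem2:
  fixes K :: "(real^'n::{finite,linorder}^'m::{finite,linorder}) set"
    and d :: nat
  assumes "d \<in> {1, 2, 3}"
    and "subspace K"
    and "dim K = d"
  shows "(\<forall>\<nu>\<in>Mpc K. \<exists>A. \<nu> = return borel A) \<longleftrightarrow> \<not> rank1_connections K"
proof -
  \<comment> \<open>In a subspace, a connection between \<open>A\<close> and \<open>B\<close> is the
    same as one between \<open>A - B\<close> and 0.\<close>
  have "rank1_connections K \<longleftrightarrow> (\<exists>C\<in>K. rank C = 1)"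
  proof
    assume "rank1_connections K"
    then show "\<exists>C\<in>K. rank C = 1"
      using subspace_diff[OF assms(2)] unfolding rank1_connections_def by blast
  next
    assume "\<exists>C\<in>K. rank C = 1"
    then obtain C where C: "C \<in> K" "rank C = 1" by blast
    then have "C \<noteq> 0" by auto
    with C show "rank1_connections K"
      unfolding rank1_connections_def
      by (intro bexI[of _ C] bexI[of _ 0]) (auto simp: subspace_0[OF assms(2)])
  qed
  moreover have "dim K \<le> 3" using assms by auto
  ultimately show ?thesis
    using Mpc_Dirac[OF assms(2)] laminate_Mpc[OF assms(2)] by metis
qed

end
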